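(* Let $\mathcal F\subseteq 2^{[n]}$ be a finite union-closed family with $N=|\mathcal F|\ge 2$. Let $P_*$ be the unique minimizer of $D(P\Vert Q)$ over $P\in\mathcal C$, let $\nu_*$ be the law of $A\cup B$ when $(A,B)\sim P_*$, and let $\nu_0$ be the law of $A\cup B$ when $A,B$ are independent and uniform on $\mathcal F$. Put $\varepsilon=1/(8\ln N)$. Then $$H(\nu_* )-H(\nu_0)\ \ge\ \varepsilon(1-\varepsilon)V\ \ge\ \frac{V}{16\ln N}\ \ge\ \frac{\ln^2(2N-1)}{64N^2\ln N}\ >\ 0.$$
   Context: A family $\mathcal F\subseteq 2^{[n]}$, $[n]=\{1,\dots,n\}$, is union-closed if $A\cup B\in\mathcal F$ whenever $A,B\in\mathcal F$. All logarithms are natural. For a probability distribution $\nu$ on a finite set, $H(\nu)=-\sum_S\nu(S)\ln\nu(S)$ with $0\ln0:=0$. For probability distributions $P,Q$ on a finite set with $Q>0$ everywhere, $D(P\Vert Q)=\sum_\omega P(\omega)\ln\frac{P(\omega)}{Q(\omega)}$, with zero summand when $P(\omega)=0$. For $S\in\mathcal F$ let $r(S)=|\{(A,B)\in\mathcal F^2: A\cup B=S\}|$ (ordered pairs; $r(S)\ge 1$). Let $Q$ be the probability distribution on $\mathcal F^2$ given by $Q(A,B)=\frac{1}{N\,r(A\cup B)}$. Let $\mathcal C$ be the set of probability distributions on $\mathcal F^2$ both of whose marginals are uniform on $\mathcal F$. The function $P\mapsto D(P\Vert Q)$ has a unique minimizer $P_*$ on $\mathcal C$ (equivalently, $P_*\in\mathcal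 C$ is of the form $P_*(A,B)=a(A)a(B)/r(A\cup B)$ with positive factors $a(A)$). The quantity $V$ is defined by $c_{AB}=\ln r(A\cup B)$, $\bar c_A=\frac1N\sum_{B\in\mathcal F}c_{AB}$, $\bar c=\frac1N\sum_{A\in\mathcal F}\bar c_A$, $R_{AB}=c_{AB}-\bar c_A-\bar c_B+\bar c$, and $V=\frac1{N^2}\sum_{A,B\in\mathcal F}R_{AB}^2$. *)

theory Defs
  imports "HOL-Probability.Probability"
begin

definition union_closed :: "'a set set \<Rightarrow> bool" where
  "union_closed F \<longleftrightarrow> (\<forall>A\<in>F. \<forall>B\<in>F. A \<union> B \<in> F)"

text \<open>Probability distributions are \<open>pmf\<close>s. The two functionals below are meant for finite
  supports; summing over the support implements the conventions for vanishing probabilities.\<close>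

definition shannon_entropy :: "'a pmf \<Rightarrow> real" where
  "shannon_entropy \<nu> = - (\<Sum>S\<in>set_pmf \<nu>. pmf \<nu> S * ln (pmf \<nu> S))"

definition relative_entropy :: "'a pmf \<Rightarrow> 'a pmf \<Rightarrow> real" where
  "relative_entropy P Q = (\<Sum>\<omega>\<in>set_pmf P. pmf P \<omega> * ln (pmf P \<omega> / pmf Q \<omega>))"

definition num_reps :: "'a set set \<Rightarrow> 'a set \<Rightarrow> nat" where
  "num_reps F S = card {(A, B). A \<in> F \<and> B \<in> F \<and> A \<union> B = S}"

text \<open>The function passed to \<open>embed_pmf\<close> is a mass function when \<open>F\<close> is finite, nonempty and
  union-closed; see \<open>pmf_ref_dist\<close> below.\<close>

definition ref_dist :: "'a set set \<Rightarrow> ('a set \<times> 'a set) pmf" where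
  "ref_dist F = embed_pmf (\<lambda>(A, B).
     if A \<in> F \<and> B \<in> F then 1 / (real (card F) * real (num_reps F (A \<union> B))) else 0)"

definition uniform_couplings :: "'a set set \<Rightarrow> ('a set \<times> 'a set) pmf set" where
  "uniform_couplings F = {P. set_pmf P \<subseteq> F \<times> F \<and>
     map_pmf fst P = pmf_of_set F \<and> map_pmf snd P = pmf_of_set F}"

definition is_optimal_coupling :: "'a set set \<Rightarrow> ('a set \<times> 'a set) pmf \<Rightarrow> bool" where
  "is_optimal_coupling F P \<longleftrightarrow>
     is_arg_min (\<lambda>P. relative_entropy P (ref_dist F)) (\<lambda>P. P \<in> uniform_couplings F) P"

definition union_law :: "('a set \<times> 'a set) pmf \<Rightarrow> 'a set pmf" where
  "union_law P = map_pmf (\<lambda>(A, B). A \<union> B) P"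

definition log_reps :: "'a set set \<Rightarrow> 'a set \<Rightarrow> 'a set \<Rightarrow> real" where
  "log_reps F A B = ln (real (num_reps F (A \<union> B)))"

definition log_reps_row :: "'a set set \<Rightarrow> 'a set \<Rightarrow> real" where
  "log_reps_row F A = (1 / real (card F)) * (\<Sum>B\<in>F. log_reps F A B)"

definition log_reps_mean :: "'a set set \<Rightarrow> real" where
  "log_reps_mean F = (1 / real (card F)) * (\<Sum>A\<in>F. log_reps_row F A)"

definition log_reps_resid :: "'a set set \<Rightarrow> 'a set \<Rightarrow> 'a set \<Rightarrow> real" where
  "log_reps_resid F A B =
     log_reps F A B - log_reps_row F A - log_reps_row F B + log_reps_mean F"

definition interaction_var :: "'a set set \<Rightarrow> real" where
  "interaction_var F = (1 / (real (card F))\<^sup>2) * (\<Sum>A\<in>F. \<Sum>B\<in>F. (log_reps_resid F A B)\<^sup>2)"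

lemma pmf_ref_dist:
  assumes fin: "finite F" and ne: "F \<noteq> {}" and uc: "union_closed F"
  shows "pmf (ref_dist F) (A, B) =
    (if A \<in> F \<and> B \<in> F then 1 / (real (card F) * real (num_reps F (A \<union> B))) else 0)"
proof -
  define f :: "'a set \<times> 'a set \<Rightarrow> real" where
    "f = (\<lambda>(A, B).
       if A \<in> F \<and> B \<in> F then 1 / (real (card F) * real (num_reps F (A \<union> B))) else 0)"
  have nn: "0 \<le> f x" for x
    by (auto simp: f_def split: prod.splits)
  have fibre: "{x \<in> F \<times> F. fst x \<union> snd x = S} = {(A, B). A \<in> F \<and> B \<in> F \<and> A \<union> B = S}" for S
    by auto
  have pos: "num_reps F S > 0" if "S \<in> F" for S
  proof -
    have "finite {x \<in> F \<times> F. fst x \<union> snd x = S}" using fin by simp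
    moreover have "(S, S) \<in> {x \<in> F \<times> F. fst x \<union> snd x = S}" using that by simp
    ultimately have "card {x \<in> F \<times> F. fst x \<union> snd x = S} \<noteq> 0"
      unfolding card_eq_0_iff by blast
    then show ?thesis
      unfolding num_reps_def fibre[symmetric] by (rule neq0_conv[THEN iffD1])
  qed
  have N: "card F > 0" using fin ne by (simp add: card_gt_0_iff)
  have "(\<Sum>x\<in>F \<times> F. f x) = (\<Sum>S\<in>F. \<Sum>x\<in>{x \<in> F \<times> F. fst x \<union> snd x = S}. f x)"
    by (rule sum.group[symmetric]) (use fin uc in \<open>auto simp: union_closed_def\<close>)
  also have "\<dots> = (\<Sum>S\<in>F. 1 / real (card F))"
  proof (rule sum.cong[OF refl])
    fix S assume S: "S \<in> F"
    have "(\<Sum>x\<in>{x \<in> F \<times> F. fst x \<union> snd x = S}. f x) =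
        (\<Sum>x\<in>{x \<in> F \<times> F. fst x \<union> snd x = S}. 1 / (real (card F) * real (num_reps F S)))"
      by (rule sum.cong) (auto simp: f_def)
    also have "\<dots> = real (num_reps F S) * (1 / (real (card F) * real (num_reps F S)))"
      by (simp add: fibre num_reps_def)
    also have "\<dots> = 1 / real (card F)" using pos[OF S] by simp
    finally show "(\<Sum>x\<in>{x \<in> F \<times> F. fst x \<union> snd x = S}. f x) = 1 / real (card F)" .
  qed
  also have "\<dots> = 1" using N by simp
  finally have one: "(\<Sum>x\<in>F \<times> F. f x) = 1" .
  have "(\<integral>\<^sup>+ x. ennreal (f x) \<partial>count_space UNIV) = (\<Sum>x\<in>F \<times> F. ennreal (f x))"
    by (rule nn_integral_count_space'[OF finite_cartesian_product[OF fin fin]])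
       (auto simp: f_def split: if_splits)
  also have "\<dots> = 1" using nn one by (simp add: sum_ennreal)
  finally have int: "(\<integral>\<^sup>+ x. ennreal (f x) \<partial>count_space UNIV) = 1" .
  have "pmf (embed_pmf f) (A, B) = f (A, B)"
    by (rule pmf_embed_pmf) (use nn int in auto)
  then show ?thesis by (simp add: ref_dist_def f_def)
qed

end

theory Submission
  imports Defs "HOL-Real_Asymp.Real_Asymp"
begin

text \<open>Write \<open>N = card F\<close>, \<open>r\<close> for \<open>num_reps F\<close>, \<open>Q\<close> for \<open>ref_dist F\<close> and \<open>U\<close> for the uniform
  distribution on \<open>F \<times> F\<close>. Under \<open>Q\<close> the union \<open>A \<union> B\<close> is uniform on \<open>F\<close>, and given the
  union the pair is uniform on its fibre. So the chain rule splits \<open>D(P || Q)\<close> into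
  \<open>ln N - H(A \<union> B)\<close> plus a nonnegative term that measures how far \<open>P\<close> is from being uniform on
  the fibres, whence \<open>H(A \<union> B) \<ge> ln N - D(P || Q)\<close> (\<open>shannon_entropy_union_law_ge\<close>). The
  distribution \<open>U\<close> is constant on fibres and gives equality
  (\<open>shannon_entropy_union_law_independent\<close>). The entropy gain of the optimal coupling \<open>P\<^sub>*\<close> is
  therefore at least \<open>D(U || Q) - D(P\<^sub>* || Q)\<close>, and by optimality at least \<open>D(U || Q) - D(P || Q)\<close>
  for every competitor \<open>P\<close> with uniform marginals.

  The competitor is \<open>P = U (1 - t R)\<close>, where \<open>R\<close> is the residual \<open>log_reps_resid\<close>. Its rows and
  columns sum to zero, so the marginals stay uniform. Since \<open>R\<close> is the projection of \<open>ln r\<close> away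
  from functions of \<open>A\<close> alone and of \<open>B\<close> alone, the expectation of \<open>ln r\<close> decreases by exactly
  \<open>t V\<close>, while \<open>x ln x \<le> x (x - 1)\<close> bounds the cost of leaving \<open>U\<close> by \<open>t\<^sup>2 V\<close>
  (\<open>tilted_coupling_decreases_relative_entropy\<close>). The bound \<open>1 \<le> r \<le> N\<^sup>2\<close> gives \<open>R \<le> 4 ln N\<close>, so
  \<open>t = 1 / (8 ln N)\<close> keeps the weights \<open>1 - t R\<close> nonnegative.

  For the bound on \<open>V\<close>, let \<open>T\<close> be the largest and \<open>M\<close> a minimal member of \<open>F\<close>. In the
  contrast \<open>R M M - R M T - R T M + R T T\<close> the row and column means cancel, which leaves
  \<open>ln (r M) - ln (r T)\<close> with \<open>r M = 1\<close> and \<open>r T \<ge> 2 N - 1\<close>; Cauchy-Schwarz then bounds the sum of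
  the squared residuals from below (\<open>interaction_var_ge\<close>).

  The optimal coupling exists by compactness and is unique because \<open>x ln x\<close> is strictly
  convex (\<open>relative_entropy_unique_minimizer\<close>).\<close>

section \<open>Convexity of \<open>x ln x\<close> and the entropy minimizer\<close>

text \<open>The tangent of \<open>x ln x\<close> at \<open>m\<close>, rearranged. Summed over the points of two distributions,
  the left-hand side cancels and what remains is Gibbs' inequality.\<close>

lemma x_ln_x_strictly_above_tangent:
  fixes a m :: real
  assumes "0 \<le> a" "0 < m" "a \<noteq> m"
  shows "a - m < a * ln a - a * ln m"
proof (cases "a = 0")
  case False
  then have pos: "0 < a" "0 < m" using assms by auto
  have "m / a \<noteq> 1" using assms pos by auto
  then have "ln (m / a) < m / a - 1"
    using ln_le_minus_one[of "m / a"] ln_eq_minus_one[of "m / a"] pos by fastforce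
  then have "a * ln (m / a) < a * (m / a - 1)"
    using pos by (intro mult_strict_left_mono) auto
  also have "a * (m / a - 1) = m - a" using pos by (simp add: right_diff_distrib)
  finally show ?thesis using pos by (simp add: ln_div right_diff_distrib)
qed (use assms in auto)

lemma x_ln_x_above_tangent:
  fixes a m :: real
  assumes "0 \<le> a" "0 \<le> m" "m = 0 \<Longrightarrow> a = 0"
  shows "a - m \<le> a * ln a - a * ln m"
proof (cases "a = m")
  case False
  then have "0 < m" using assms by linarith
  then show ?thesis using x_ln_x_strictly_above_tangent[of a m] False assms by simp
qed simp

text \<open>Both points are compared with the tangent at their midpoint, where the linear terms
  cancel.\<close>

lemma x_ln_x_midpoint_convex:
  fixes a b :: real
  assumes "0 \<le> a" "0 \<le> b" and "m = (a + b) / 2"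
  shows "2 * (m * ln m) \<le> a * ln a + b * ln b"
    and "a \<noteq> b \<Longrightarrow> 2 * (m * ln m) < a * ln a + b * ln b"
proof -
  have m: "0 \<le> m" "m = 0 \<Longrightarrow> a = 0" "m = 0 \<Longrightarrow> b = 0" "2 * m = a + b"
    using assms by simp_all
  have "2 * (m * ln m) = (a + b) * ln m" by (simp flip: m(4))
  then have eq: "2 * (m * ln m) = a * ln m + b * ln m" by (simp add: distrib_right)
  show "2 * (m * ln m) \<le> a * ln a + b * ln b"
    using x_ln_x_above_tangent[of a m] x_ln_x_above_tangent[of b m] m assms(1,2) eq by linarith
  assume "a \<noteq> b"
  then have "0 < m" "a \<noteq> m" "b \<noteq> m" using m assms(1,2) by linarith+
  then show "2 * (m * ln m) < a * ln a + b * ln b"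
    using x_ln_x_strictly_above_tangent[of a m] x_ln_x_strictly_above_tangent[of b m] m(4) assms(1,2) eq
    by linarith
qed

text \<open>The value \<open>0\<close> at \<open>0\<close> is the limit there, so zero can be included: minimizers of relative entropy are sought
  among distributions that may vanish at some points.\<close>

lemma continuous_on_x_ln_x: "continuous_on {0..} (\<lambda>x::real. x * ln x)"
  unfolding continuous_on_def
proof
  fix x :: real assume "x \<in> {0..}"
  then consider "x = 0" | "0 < x" by fastforce
  then show "((\<lambda>x. x * ln x) \<longlongrightarrow> x * ln x) (at x within {0..})"
  proof cases
    case 1
    have "((\<lambda>x::real. x * ln x) \<longlongrightarrow> 0) (at_right 0)" by real_asymp
    then show ?thesis using 1 by (simp add: at_within_Ici_at_right)
  next
    case 2
    then show ?thesis by (intro tendsto_intros) auto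
  qed
qed

text \<open>Summing over a fixed set instead of the support makes relative entropy a function of the
  point masses that is visibly continuous, with an affine second term.\<close>

lemma relative_entropy_finite:
  assumes "finite \<Omega>" "set_pmf P \<subseteq> \<Omega>" and Q: "\<And>\<omega>. \<omega> \<in> \<Omega> \<Longrightarrow> 0 < pmf Q \<omega>"
  shows "relative_entropy P Q =
    (\<Sum>\<omega>\<in>\<Omega>. pmf P \<omega> * ln (pmf P \<omega>) - pmf P \<omega> * ln (pmf Q \<omega>))"
proof -
  have "relative_entropy P Q = (\<Sum>\<omega>\<in>\<Omega>. pmf P \<omega> * ln (pmf P \<omega> / pmf Q \<omega>))"
    unfolding relative_entropy_def
    by (rule sum.mono_neutral_left) (use assms in \<open>auto simp: set_pmf_iff\<close>)
  also have "\<dots> = (\<Sum>\<omega>\<in>\<Omega>. pmf P \<omega> * ln (pmf P \<omega>) - pmf P \<omega> * ln (pmf Q \<omega>))"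
  proof (rule sum.cong[OF refl])
    fix \<omega> assume "\<omega> \<in> \<Omega>"
    then show "pmf P \<omega> * ln (pmf P \<omega> / pmf Q \<omega>) =
        pmf P \<omega> * ln (pmf P \<omega>) - pmf P \<omega> * ln (pmf Q \<omega>)"
      using Q[of \<omega>] pmf_nonneg[of P \<omega>]
      by (cases "pmf P \<omega> = 0") (auto simp: ln_div less_le algebra_simps)
  qed
  finally show ?thesis .
qed

text \<open>Point masses lie in \<open>[0, 1]\<close>, so Tychonoff's theorem applies in the product
  topology on functions.\<close>

lemma compact_closed_pmf_image:
  fixes C :: "'a pmf set"
  assumes "closed (pmf ` C)"
  shows "compact (pmf ` C)"
proof -
  have "compactin (product_topology (\<lambda>_::'a. euclidean :: real topology) UNIV)
      (PiE UNIV (\<lambda>_. {0..1}))"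
    by (simp add: compactin_PiE)
  then have "compact (PiE UNIV (\<lambda>_::'a. {0..1::real}))"
    by (simp add: euclidean_product_topology)
  then have "compact (pmf ` C \<inter> PiE UNIV (\<lambda>_. {0..1}))"
    using assms by (rule closed_Int_compact[rotated])
  moreover have "pmf ` C \<inter> PiE UNIV (\<lambda>_. {0..1}) = pmf ` C"
    by (auto simp: pmf_le_1)
  ultimately show ?thesis by simp
qed

text \<open>A continuous function on a compact set has a minimizer; if there were two, strict convexity
  would make their midpoint better than both.\<close>

theorem relative_entropy_unique_minimizer:
  assumes fin: "finite \<Omega>" and Q: "\<And>\<omega>. \<omega> \<in> \<Omega> \<Longrightarrow> 0 < pmf Q \<omega>"
    and supp: "\<And>P. P \<in> C \<Longrightarrow> set_pmf P \<subseteq> \<Omega>"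
    and ne: "C \<noteq> {}" and cl: "closed (pmf ` C)"
    and mid: "\<And>P P'. P \<in> C \<Longrightarrow> P' \<in> C \<Longrightarrow>
      \<exists>M\<in>C. \<forall>\<omega>. pmf M \<omega> = (pmf P \<omega> + pmf P' \<omega>) / 2"
  shows "\<exists>!P. is_arg_min (\<lambda>P. relative_entropy P Q) (\<lambda>P. P \<in> C) P"
proof -
  define h where "h f = (\<Sum>\<omega>\<in>\<Omega>. f \<omega> * ln (f \<omega>) - f \<omega> * ln (pmf Q \<omega>))" for f :: "'a \<Rightarrow> real"
  have h: "relative_entropy P Q = h (pmf P)" if "P \<in> C" for P
    unfolding h_def by (rule relative_entropy_finite[OF fin supp[OF that] Q])
  have "continuous_on (pmf ` C) h"
    unfolding h_def
    by (intro continuous_on_sum continuous_on_diff continuous_on_mult_right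
        continuous_on_compose2[OF continuous_on_x_ln_x]
        continuous_on_subset[OF continuous_on_product_coordinates]) auto
  then obtain P where P: "P \<in> C" "\<And>P'. P' \<in> C \<Longrightarrow> h (pmf P) \<le> h (pmf P')"
    using continuous_attains_inf[OF compact_closed_pmf_image[OF cl], of h] ne by auto
  show ?thesis
  proof (rule ex1I)
    show "is_arg_min (\<lambda>P. relative_entropy P Q) (\<lambda>P. P \<in> C) P"
      using P by (auto simp: is_arg_min_linorder h)
    fix P' assume "is_arg_min (\<lambda>P. relative_entropy P Q) (\<lambda>P. P \<in> C) P'"
    then have P': "P' \<in> C" "\<And>R. R \<in> C \<Longrightarrow> h (pmf P') \<le> h (pmf R)"
      by (auto simp: is_arg_min_linorder h)
    show "P' = P"
    proof (rule ccontr)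
      assume "P' \<noteq> P"
      then obtain \<omega> where \<omega>: "pmf P' \<omega> \<noteq> pmf P \<omega>" by (auto simp: pmf_eq_iff)
      then have "\<omega> \<in> \<Omega>" using supp[OF P(1)] supp[OF P'(1)] by (metis set_pmf_iff subsetD)
      obtain M where M: "M \<in> C" "\<And>\<omega>. pmf M \<omega> = (pmf P' \<omega> + pmf P \<omega>) / 2"
        using mid[OF P'(1) P(1)] by auto
      have lin: "2 * (pmf M \<omega> * q) = pmf P' \<omega> * q + pmf P \<omega> * q" for \<omega> q
        by (simp add: M(2) algebra_simps)
      have "(\<Sum>\<omega>\<in>\<Omega>. 2 * (pmf M \<omega> * ln (pmf M \<omega>) - pmf M \<omega> * ln (pmf Q \<omega>))) <
          (\<Sum>\<omega>\<in>\<Omega>. (pmf P' \<omega> * ln (pmf P' \<omega>) - pmf P' \<omega> * ln (pmf Q \<omega>))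
            + (pmf P \<omega> * ln (pmf P \<omega>) - pmf P \<omega> * ln (pmf Q \<omega>)))"
      proof (rule sum_strict_mono_ex1[OF fin])
        show "\<forall>\<omega>\<in>\<Omega>. 2 * (pmf M \<omega> * ln (pmf M \<omega>) - pmf M \<omega> * ln (pmf Q \<omega>))
            \<le> (pmf P' \<omega> * ln (pmf P' \<omega>) - pmf P' \<omega> * ln (pmf Q \<omega>))
              + (pmf P \<omega> * ln (pmf P \<omega>) - pmf P \<omega> * ln (pmf Q \<omega>))"
          using x_ln_x_midpoint_convex(1)[OF pmf_nonneg pmf_nonneg M(2)] lin
          by (simp add: right_diff_distrib)
        show "\<exists>\<omega>\<in>\<Omega>. 2 * (pmf M \<omega> * ln (pmf M \<omega>) - pmf M \<omega> * ln (pmf Q \<omega>))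
            < (pmf P' \<omega> * ln (pmf P' \<omega>) - pmf P' \<omega> * ln (pmf Q \<omega>))
              + (pmf P \<omega> * ln (pmf P \<omega>) - pmf P \<omega> * ln (pmf Q \<omega>))"
          using x_ln_x_midpoint_convex(2)[OF pmf_nonneg pmf_nonneg M(2) \<omega>] lin \<open>\<omega> \<in> \<Omega>\<close>
          by (intro bexI[of _ \<omega>]) (simp_all add: right_diff_distrib)
      qed
      then have "2 * h (pmf M) < h (pmf P') + h (pmf P)"
        by (simp add: h_def sum_distrib_left sum.distrib)
      then show False using P(2)[OF M(1)] P'(2)[OF M(1)] by simp
    qed
  qed
qed

section \<open>The polytope of uniform couplings\<close>

lemma pmf_map_finite:
  assumes "finite \<Omega>" "set_pmf P \<subseteq> \<Omega>"
  shows "pmf (map_pmf f P) x = (\<Sum>\<omega>\<in>{\<omega>\<in>\<Omega>. f \<omega> = x}. pmf P \<omega>)"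
proof -
  have "measure_pmf.prob P (f -` {x}) = measure_pmf.prob P {\<omega>\<in>\<Omega>. f \<omega> = x}"
    by (rule measure_pmf.finite_measure_eq_AE) (use assms in \<open>auto simp: AE_measure_pmf_iff\<close>)
  then show ?thesis using assms by (simp add: pmf_map measure_measure_pmf_finite)
qed

lemma pmf_with_finite_support_exists:
  fixes f :: "'a \<Rightarrow> real"
  assumes "finite \<Omega>" "\<And>\<omega>. 0 \<le> f \<omega>" "\<And>\<omega>. \<omega> \<notin> \<Omega> \<Longrightarrow> f \<omega> = 0" "(\<Sum>\<omega>\<in>\<Omega>. f \<omega>) = 1"
  shows "\<exists>P. pmf P = f"
proof -
  have "(\<integral>\<^sup>+ \<omega>. ennreal (f \<omega>) \<partial>count_space UNIV) = (\<Sum>\<omega>\<in>\<Omega>. ennreal (f \<omega>))"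
    by (rule nn_integral_count_space'[OF assms(1)]) (use assms in auto)
  also have "\<dots> = 1" using assms by (simp add: sum_ennreal)
  finally have "pmf (embed_pmf f) \<omega> = f \<omega>" for \<omega>
    by (intro pmf_embed_pmf) (use assms in auto)
  then show ?thesis by blast
qed

text \<open>The couplings as mass functions cut out by linear constraints: in this form closedness
  and stability under midpoints are immediate, and new couplings can be given by a formula.\<close>

definition coupling_polytope :: "'a set set \<Rightarrow> ('a set \<times> 'a set \<Rightarrow> real) set" where
  "coupling_polytope F = {f. (\<forall>\<omega>. 0 \<le> f \<omega>) \<and> (\<forall>\<omega>. \<omega> \<notin> F \<times> F \<longrightarrow> f \<omega> = 0) \<and>
     (\<forall>A\<in>F. (\<Sum>B\<in>F. f (A, B)) = 1 / real (card F)) \<and>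
     (\<forall>B\<in>F. (\<Sum>A\<in>F. f (A, B)) = 1 / real (card F))}"

lemma marginals_eq_sums:
  assumes "finite F" "F \<noteq> {}" and P: "set_pmf P \<subseteq> F \<times> F"
  shows "map_pmf fst P = pmf_of_set F \<longleftrightarrow> (\<forall>A\<in>F. (\<Sum>B\<in>F. pmf P (A, B)) = 1 / real (card F))"
    and "map_pmf snd P = pmf_of_set F \<longleftrightarrow> (\<forall>B\<in>F. (\<Sum>A\<in>F. pmf P (A, B)) = 1 / real (card F))"
proof -
  have fin: "finite (F \<times> F)" using assms by simp
  have "pmf (map_pmf fst P) A = (if A \<in> F then \<Sum>B\<in>F. pmf P (A, B) else 0)" for A
  proof -
    have "{\<omega>\<in>F \<times> F. fst \<omega> = A} = (if A \<in> F then Pair A ` F else {})" by auto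
    then show ?thesis
      unfolding pmf_map_finite[OF fin P] by (auto simp: sum.reindex inj_on_def)
  qed
  then show "map_pmf fst P = pmf_of_set F \<longleftrightarrow>
      (\<forall>A\<in>F. (\<Sum>B\<in>F. pmf P (A, B)) = 1 / real (card F))"
    using assms by (auto simp: pmf_eq_iff indicator_def)
  have "pmf (map_pmf snd P) B = (if B \<in> F then \<Sum>A\<in>F. pmf P (A, B) else 0)" for B
  proof -
    have "{\<omega>\<in>F \<times> F. snd \<omega> = B} = (if B \<in> F then (\<lambda>A. (A, B)) ` F else {})" by auto
    then show ?thesis
      unfolding pmf_map_finite[OF fin P] by (auto simp: sum.reindex inj_on_def)
  qed
  then show "map_pmf snd P = pmf_of_set F \<longleftrightarrow>
      (\<forall>B\<in>F. (\<Sum>A\<in>F. pmf P (A, B)) = 1 / real (card F))"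
    using assms by (auto simp: pmf_eq_iff indicator_def)
qed

lemma pmf_image_uniform_couplings:
  assumes "finite F" "F \<noteq> {}"
  shows "pmf ` uniform_couplings F = coupling_polytope F"
proof (intro set_eqI iffI)
  fix f assume "f \<in> pmf ` uniform_couplings F"
  then obtain P where P: "f = pmf P" "P \<in> uniform_couplings F" by auto
  then have "set_pmf P \<subseteq> F \<times> F" by (simp add: uniform_couplings_def)
  with P marginals_eq_sums[OF assms this] show "f \<in> coupling_polytope F"
    by (auto simp: uniform_couplings_def coupling_polytope_def set_pmf_iff)
next
  fix f assume f: "f \<in> coupling_polytope F"
  have "(\<Sum>\<omega>\<in>F \<times> F. f \<omega>) = (\<Sum>A\<in>F. \<Sum>B\<in>F. f (A, B))"
    by (simp add: sum.cartesian_product)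
  also have "\<dots> = 1" using f assms by (simp add: coupling_polytope_def)
  finally have "\<exists>P. pmf P = f"
    using f assms
    by (intro pmf_with_finite_support_exists[of "F \<times> F" f]) (auto simp: coupling_polytope_def)
  then obtain P where P: "pmf P = f" ..
  have supp: "set_pmf P \<subseteq> F \<times> F"
    using f unfolding coupling_polytope_def set_pmf_eq P by blast
  then have "P \<in> uniform_couplings F"
    using marginals_eq_sums[OF assms supp] f
    by (simp add: uniform_couplings_def coupling_polytope_def P)
  then show "f \<in> pmf ` uniform_couplings F" using P by auto
qed

lemma closed_coupling_polytope: "closed (coupling_polytope F)"
proof -
  have coord: "continuous_on UNIV (\<lambda>f :: 'a set \<times> 'a set \<Rightarrow> real. f \<omega>)" for \<omega>
    by (rule continuous_on_product_coordinates)
  have "coupling_polytope F = (\<Inter>\<omega>. {f. 0 \<le> f \<omega>}) \<inter> (\<Inter>\<omega>\<in>- (F \<times> F). {f. f \<omega> = 0}) \<inter>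
      (\<Inter>A\<in>F. {f. (\<Sum>B\<in>F. f (A, B)) = 1 / real (card F)}) \<inter>
      (\<Inter>B\<in>F. {f. (\<Sum>A\<in>F. f (A, B)) = 1 / real (card F)})"
    by (auto simp: coupling_polytope_def)
  also have "closed \<dots>"
    by (intro closed_Int closed_INT ballI closed_Collect_le closed_Collect_eq
        continuous_on_sum continuous_on_const coord)
  finally show ?thesis .
qed

lemma num_reps_pos:
  assumes "finite F" "A \<in> F" "B \<in> F"
  shows "0 < num_reps F (A \<union> B)"
proof -
  have "finite {(X, Y). X \<in> F \<and> Y \<in> F \<and> X \<union> Y = A \<union> B}"
    by (rule finite_subset[of _ "F \<times> F"]) (use assms in auto)
  then show ?thesis unfolding num_reps_def card_gt_0_iff using assms by blast
qed

lemma num_reps_le_card_squared: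
  assumes "finite F"
  shows "num_reps F S \<le> (card F)\<^sup>2"
proof -
  have "num_reps F S \<le> card (F \<times> F)"
    unfolding num_reps_def by (rule card_mono) (use assms in auto)
  then show ?thesis by (simp add: card_cartesian_product power2_eq_square)
qed

lemma log_reps_bounds:
  assumes "finite F" "A \<in> F" "B \<in> F"
  shows "0 \<le> log_reps F A B" "log_reps F A B \<le> 2 * ln (real (card F))"
proof -
  have r: "0 < num_reps F (A \<union> B)" by (rule num_reps_pos[OF assms])
  then show "0 \<le> log_reps F A B" by (simp add: log_reps_def)
  have "real (num_reps F (A \<union> B)) \<le> real (card F) ^ 2"
    using num_reps_le_card_squared[OF assms(1)] by (metis of_nat_le_iff of_nat_power)
  then have "log_reps F A B \<le> ln (real (card F) ^ 2)"
    unfolding log_reps_def using r by (intro ln_mono) auto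
  also have "\<dots> = 2 * ln (real (card F))"
    using assms by (subst ln_realpow) (auto simp: card_gt_0_iff)
  finally show "log_reps F A B \<le> 2 * ln (real (card F))" .
qed

theorem ex1_optimal_coupling:
  assumes fin: "finite F" and ne: "F \<noteq> {}" and uc: "union_closed F"
  shows "\<exists>!P. is_optimal_coupling F P"
  unfolding is_optimal_coupling_def
proof (rule relative_entropy_unique_minimizer)
  note img = pmf_image_uniform_couplings[OF fin ne]
  show "finite (F \<times> F)" using fin by simp
  have "0 < card F" using fin ne by (simp add: card_gt_0_iff)
  then show "0 < pmf (ref_dist F) \<omega>" if "\<omega> \<in> F \<times> F" for \<omega>
    using that num_reps_pos[OF fin] by (auto simp: pmf_ref_dist[OF fin ne uc])
  show "set_pmf P \<subseteq> F \<times> F" if "P \<in> uniform_couplings F" for P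
    using that by (simp add: uniform_couplings_def)
  have "pair_pmf (pmf_of_set F) (pmf_of_set F) \<in> uniform_couplings F"
    using fin ne by (simp add: uniform_couplings_def map_fst_pair_pmf map_snd_pair_pmf)
  then show "uniform_couplings F \<noteq> {}" by auto
  show "closed (pmf ` uniform_couplings F)"
    unfolding img by (rule closed_coupling_polytope)
  fix P P' assume "P \<in> uniform_couplings F" "P' \<in> uniform_couplings F"
  then have "pmf P \<in> coupling_polytope F" "pmf P' \<in> coupling_polytope F"
    using img by auto
  then have "(\<lambda>\<omega>. (pmf P \<omega> + pmf P' \<omega>) / 2) \<in> coupling_polytope F"
    by (auto simp: coupling_polytope_def sum.distrib simp flip: sum_divide_distrib)
  then obtain M where "M \<in> uniform_couplings F" "pmf M = (\<lambda>\<omega>. (pmf P \<omega> + pmf P' \<omega>) / 2)"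
    unfolding img[symmetric] by auto
  then show "\<exists>M\<in>uniform_couplings F. \<forall>\<omega>. pmf M \<omega> = (pmf P \<omega> + pmf P' \<omega>) / 2"
    by (intro bexI[of _ M]) simp_all
qed

section \<open>Entropy of the union\<close>

lemma relative_entropy_ref_dist:
  assumes fin: "finite F" and ne: "F \<noteq> {}" and uc: "union_closed F"
    and P: "set_pmf P \<subseteq> F \<times> F"
  shows "relative_entropy P (ref_dist F) = ln (real (card F)) +
    (\<Sum>\<omega>\<in>F \<times> F. pmf P \<omega> * ln (pmf P \<omega>) + pmf P \<omega> * log_reps F (fst \<omega>) (snd \<omega>))"
proof -
  have N: "0 < card F" using fin ne by (simp add: card_gt_0_iff)
  have ff: "finite (F \<times> F)" using fin by simp
  have Q: "0 < pmf (ref_dist F) \<omega>"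
    and lnQ: "ln (pmf (ref_dist F) \<omega>) = - ln (real (card F)) - log_reps F (fst \<omega>) (snd \<omega>)"
    if "\<omega> \<in> F \<times> F" for \<omega>
    using that num_reps_pos[OF fin, of "fst \<omega>" "snd \<omega>"] N
    by (auto simp: pmf_ref_dist[OF fin ne uc] log_reps_def ln_div ln_mult)
  have "relative_entropy P (ref_dist F) =
      (\<Sum>\<omega>\<in>F \<times> F. ln (real (card F)) * pmf P \<omega>
        + (pmf P \<omega> * ln (pmf P \<omega>) + pmf P \<omega> * log_reps F (fst \<omega>) (snd \<omega>)))"
    by (subst relative_entropy_finite[OF ff P Q])
       (auto intro!: sum.cong simp: lnQ algebra_simps)
  also have "\<dots> = ln (real (card F)) * (\<Sum>\<omega>\<in>F \<times> F. pmf P \<omega>) +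
      (\<Sum>\<omega>\<in>F \<times> F. pmf P \<omega> * ln (pmf P \<omega>) + pmf P \<omega> * log_reps F (fst \<omega>) (snd \<omega>))"
    by (simp add: sum.distrib sum_distrib_left)
  finally show ?thesis by (simp add: sum_pmf_eq_1[OF ff P])
qed

lemma shannon_entropy_union_law:
  assumes fin: "finite F" and P: "set_pmf P \<subseteq> F \<times> F"
  shows "shannon_entropy (union_law P) =
    - (\<Sum>\<omega>\<in>F \<times> F. pmf P \<omega> * ln (pmf (union_law P) (fst \<omega> \<union> snd \<omega>)))"
proof -
  let ?\<nu> = "union_law P"
  have ff: "finite (F \<times> F)" using fin by simp
  have "finite (set_pmf ?\<nu>)"
    unfolding union_law_def set_map_pmf using finite_subset[OF P ff] by simp
  then have "shannon_entropy ?\<nu> = - measure_pmf.expectation ?\<nu> (\<lambda>S. ln (pmf ?\<nu> S))"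
    unfolding shannon_entropy_def
    by (subst integral_measure_pmf_real[of "set_pmf ?\<nu>"]) (auto simp: mult.commute)
  also have "measure_pmf.expectation ?\<nu> (\<lambda>S. ln (pmf ?\<nu> S)) =
      measure_pmf.expectation P (\<lambda>\<omega>. ln (pmf ?\<nu> (fst \<omega> \<union> snd \<omega>)))"
    by (subst (1) union_law_def) (simp add: case_prod_beta)
  also have "\<dots> = (\<Sum>\<omega>\<in>F \<times> F. pmf P \<omega> * ln (pmf ?\<nu> (fst \<omega> \<union> snd \<omega>)))"
    by (subst integral_measure_pmf_real[OF ff]) (use P in \<open>auto simp: mult.commute\<close>)
  finally show ?thesis .
qed

text \<open>The fibre over \<open>S\<close> has \<open>num_reps F S\<close> elements, so dividing the mass at \<open>S\<close> evenly among
  them preserves the total.\<close>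

lemma sum_spread_over_fibres:
  fixes g :: "'a set \<Rightarrow> real"
  assumes fin: "finite F" and uc: "union_closed F"
  shows "(\<Sum>\<omega>\<in>F \<times> F. g (fst \<omega> \<union> snd \<omega>) / real (num_reps F (fst \<omega> \<union> snd \<omega>))) = (\<Sum>S\<in>F. g S)"
proof -
  have "(\<Sum>\<omega>\<in>F \<times> F. g (fst \<omega> \<union> snd \<omega>) / real (num_reps F (fst \<omega> \<union> snd \<omega>))) =
      (\<Sum>S\<in>F. \<Sum>\<omega>\<in>{\<omega>\<in>F \<times> F. fst \<omega> \<union> snd \<omega> = S}.
        g (fst \<omega> \<union> snd \<omega>) / real (num_reps F (fst \<omega> \<union> snd \<omega>)))"
    by (rule sum.group[symmetric]) (use fin uc in \<open>auto simp: union_closed_def\<close>)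
  also have "\<dots> = (\<Sum>S\<in>F. g S)"
  proof (rule sum.cong[OF refl])
    fix S assume S: "S \<in> F"
    have "{\<omega>\<in>F \<times> F. fst \<omega> \<union> snd \<omega> = S} = {(A, B). A \<in> F \<and> B \<in> F \<and> A \<union> B = S}" by auto
    then have "card {\<omega>\<in>F \<times> F. fst \<omega> \<union> snd \<omega> = S} = num_reps F S" by (simp add: num_reps_def)
    then show "(\<Sum>\<omega>\<in>{\<omega>\<in>F \<times> F. fst \<omega> \<union> snd \<omega> = S}.
        g (fst \<omega> \<union> snd \<omega>) / real (num_reps F (fst \<omega> \<union> snd \<omega>))) = g S"
      using num_reps_pos[OF fin S S] by simp
  qed
  finally show ?thesis .
qed

text \<open>Gibbs' inequality for \<open>P\<close> against the distribution \<open>m\<close> with the same union law that is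
  uniform on every fibre. Since \<open>ln m = ln \<nu> - ln r\<close>, the cross term
  produces exactly the entropy of the union and the \<open>ln r\<close> part of the relative entropy.\<close>

lemma shannon_entropy_union_law_ge:
  assumes fin: "finite F" and ne: "F \<noteq> {}" and uc: "union_closed F"
    and P: "set_pmf P \<subseteq> F \<times> F"
  shows "ln (real (card F)) - relative_entropy P (ref_dist F) \<le> shannon_entropy (union_law P)"
proof -
  let ?\<nu> = "union_law P"
  define m where "m \<omega> = pmf ?\<nu> (fst \<omega> \<union> snd \<omega>) / real (num_reps F (fst \<omega> \<union> snd \<omega>))" for \<omega>
  have ff: "finite (F \<times> F)" using fin by simp
  have \<nu>: "set_pmf ?\<nu> \<subseteq> F"
    using P uc by (auto simp: union_law_def union_closed_def)
  have "(\<Sum>\<omega>\<in>F \<times> F. m \<omega>) = 1"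
    unfolding m_def sum_spread_over_fibres[OF fin uc] by (rule sum_pmf_eq_1[OF fin \<nu>])
  then have "0 = (\<Sum>\<omega>\<in>F \<times> F. pmf P \<omega> - m \<omega>)"
    by (simp add: sum_subtractf sum_pmf_eq_1[OF ff P])
  also have "\<dots> \<le> (\<Sum>\<omega>\<in>F \<times> F. (pmf P \<omega> * ln (pmf P \<omega>) + pmf P \<omega> * log_reps F (fst \<omega>) (snd \<omega>))
      - pmf P \<omega> * ln (pmf ?\<nu> (fst \<omega> \<union> snd \<omega>)))"
  proof (rule sum_mono)
    fix \<omega> assume \<omega>: "\<omega> \<in> F \<times> F"
    have r: "0 < num_reps F (fst \<omega> \<union> snd \<omega>)" using \<omega> num_reps_pos[OF fin] by auto
    have zero: "pmf P \<omega> = 0" if "pmf ?\<nu> (fst \<omega> \<union> snd \<omega>) = 0"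
    proof (rule ccontr)
      assume "pmf P \<omega> \<noteq> 0"
      then have "\<omega> \<in> set_pmf P" by (simp add: set_pmf_iff)
      then have "fst \<omega> \<union> snd \<omega> \<in> set_pmf ?\<nu>"
        by (auto simp: union_law_def case_prod_beta)
      then show False using that by (simp add: set_pmf_iff)
    qed
    have "pmf P \<omega> - m \<omega> \<le> pmf P \<omega> * ln (pmf P \<omega>) - pmf P \<omega> * ln (m \<omega>)"
      by (rule x_ln_x_above_tangent) (use zero r in \<open>auto simp: m_def\<close>)
    also have "pmf P \<omega> * ln (m \<omega>) = pmf P \<omega> * ln (pmf ?\<nu> (fst \<omega> \<union> snd \<omega>))
        - pmf P \<omega> * log_reps F (fst \<omega>) (snd \<omega>)"
    proof (cases "pmf ?\<nu> (fst \<omega> \<union> snd \<omega>) = 0")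
      case False
      then have "0 < pmf ?\<nu> (fst \<omega> \<union> snd \<omega>)" by (simp add: less_le)
      then show ?thesis using r by (simp add: m_def log_reps_def ln_div right_diff_distrib)
    qed (simp add: zero)
    finally show "pmf P \<omega> - m \<omega> \<le>
      (pmf P \<omega> * ln (pmf P \<omega>) + pmf P \<omega> * log_reps F (fst \<omega>) (snd \<omega>))
        - pmf P \<omega> * ln (pmf ?\<nu> (fst \<omega> \<union> snd \<omega>))" by simp
  qed
  finally show ?thesis
    unfolding relative_entropy_ref_dist[OF assms] shannon_entropy_union_law[OF fin P]
    by (simp add: sum_subtractf)
qed

lemma pmf_independent_pair:
  assumes "finite F" "F \<noteq> {}" "\<omega> \<in> F \<times> F"
  shows "pmf (pair_pmf (pmf_of_set F) (pmf_of_set F)) \<omega> = 1 / (real (card F))\<^sup>2"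
  using assms by (cases \<omega>) (auto simp: pmf_pair power2_eq_square)

text \<open>A product of uniform distributions is constant on fibres, which is the equality case of
  the preceding inequality.\<close>

lemma shannon_entropy_union_law_independent:
  assumes fin: "finite F" and ne: "F \<noteq> {}" and uc: "union_closed F"
  defines "U \<equiv> pair_pmf (pmf_of_set F) (pmf_of_set F)"
  shows "shannon_entropy (union_law U) = ln (real (card F)) - relative_entropy U (ref_dist F)"
proof -
  have N: "0 < card F" using fin ne by (simp add: card_gt_0_iff)
  have U: "set_pmf U \<subseteq> F \<times> F" using fin ne by (simp add: U_def)
  have pU: "pmf U \<omega> = 1 / (real (card F))\<^sup>2" if "\<omega> \<in> F \<times> F" for \<omega>
    unfolding U_def by (rule pmf_independent_pair[OF fin ne that])
  have "pmf (union_law U) S = real (num_reps F S) / (real (card F))\<^sup>2" for S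
  proof -
    have "pmf (union_law U) S = (\<Sum>\<omega>\<in>{\<omega>\<in>F \<times> F. (case \<omega> of (A, B) \<Rightarrow> A \<union> B) = S}. pmf U \<omega>)"
      unfolding union_law_def using fin by (intro pmf_map_finite[OF _ U]) simp
    also have "\<dots> = (\<Sum>\<omega>\<in>{(A, B). A \<in> F \<and> B \<in> F \<and> A \<union> B = S}. 1 / (real (card F))\<^sup>2)"
      by (rule sum.cong) (auto simp: pU)
    finally show ?thesis by (simp add: num_reps_def)
  qed
  then have "pmf U \<omega> * ln (pmf (union_law U) (fst \<omega> \<union> snd \<omega>)) =
      pmf U \<omega> * ln (pmf U \<omega>) + pmf U \<omega> * log_reps F (fst \<omega>) (snd \<omega>)" if "\<omega> \<in> F \<times> F" for \<omega>
    using that N num_reps_pos[OF fin, of "fst \<omega>" "snd \<omega>"]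
    by (auto simp: pU log_reps_def ln_div diff_divide_distrib)
  then show ?thesis
    unfolding relative_entropy_ref_dist[OF fin ne uc U] shannon_entropy_union_law[OF fin U]
    by simp
qed

section \<open>Tilting the product coupling along the residual\<close>

lemma log_reps_resid_commute: "log_reps_resid F A B = log_reps_resid F B A"
  by (simp add: log_reps_resid_def log_reps_def Un_commute)

lemma sum_log_reps_resid:
  assumes "finite F" "F \<noteq> {}"
  shows "(\<Sum>B\<in>F. log_reps_resid F A B) = 0"
proof -
  have "0 < card F" using assms by (simp add: card_gt_0_iff)
  then have "(\<Sum>B\<in>F. log_reps F A B) = real (card F) * log_reps_row F A"
    "(\<Sum>B\<in>F. log_reps_row F B) = real (card F) * log_reps_mean F"
    by (simp_all add: log_reps_row_def log_reps_mean_def)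
  then show ?thesis by (simp add: log_reps_resid_def sum.distrib sum_subtractf algebra_simps)
qed

lemma log_reps_resid_le:
  assumes fin: "finite F" and "A \<in> F" "B \<in> F"
  shows "log_reps_resid F A B \<le> 4 * ln (real (card F))"
proof -
  have N: "0 < card F" using assms by (auto simp: card_gt_0_iff)
  have row: "0 \<le> log_reps_row F X" "log_reps_row F X \<le> 2 * ln (real (card F))" if "X \<in> F" for X
  proof -
    show "0 \<le> log_reps_row F X"
      unfolding log_reps_row_def using log_reps_bounds[OF fin that]
      by (intro mult_nonneg_nonneg sum_nonneg) auto
    have "(\<Sum>Y\<in>F. log_reps F X Y) \<le> real (card F) * (2 * ln (real (card F)))"
      using log_reps_bounds[OF fin that] by (intro sum_bounded_above) auto
    then show "log_reps_row F X \<le> 2 * ln (real (card F))"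
      unfolding log_reps_row_def using N by (simp add: field_simps)
  qed
  have "(\<Sum>X\<in>F. log_reps_row F X) \<le> real (card F) * (2 * ln (real (card F)))"
    using row by (intro sum_bounded_above) auto
  then have "log_reps_mean F \<le> 2 * ln (real (card F))"
    unfolding log_reps_mean_def using N by (simp add: field_simps)
  then show ?thesis
    using row[OF assms(2)] row[OF assms(3)] log_reps_bounds(2)[OF assms]
    by (simp add: log_reps_resid_def)
qed

text \<open>The residual is orthogonal to every function of one coordinate, and it differs from
  \<open>log_reps\<close> by such functions.\<close>

lemma sum_resid_times_log_reps:
  assumes "finite F" "F \<noteq> {}"
  shows "(\<Sum>A\<in>F. \<Sum>B\<in>F. log_reps_resid F A B * log_reps F A B) =
    (\<Sum>A\<in>F. \<Sum>B\<in>F. (log_reps_resid F A B)\<^sup>2)"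
proof -
  let ?R = "log_reps_resid F"
  have row: "(\<Sum>A\<in>F. \<Sum>B\<in>F. ?R A B * u A) = 0" for u
    by (simp add: sum_log_reps_resid[OF assms] flip: sum_distrib_right)
  have col: "(\<Sum>A\<in>F. \<Sum>B\<in>F. ?R A B * u B) = 0" for u
  proof -
    have "(\<Sum>A\<in>F. \<Sum>B\<in>F. ?R A B * u B) = (\<Sum>B\<in>F. \<Sum>A\<in>F. ?R B A * u B)"
      by (subst sum.swap) (intro sum.cong refl, metis log_reps_resid_commute)
    then show ?thesis by (simp add: row)
  qed
  have "?R A B * log_reps F A B =
      (?R A B)\<^sup>2 + ?R A B * log_reps_row F A + ?R A B * (log_reps_row F B - log_reps_mean F)"
    for A B
    by (simp add: log_reps_resid_def power2_eq_square algebra_simps)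
  then show ?thesis
    using row[of "log_reps_row F"] col[of "\<lambda>B. log_reps_row F B - log_reps_mean F"]
    by (simp add: sum.distrib)
qed

text \<open>The coupling is \<open>P = (1 - t R) / N\<^sup>2\<close>; it need not be the best one, but its relative entropy
  is a quadratic in \<open>t\<close> up to the estimate \<open>x ln x \<le> x (x - 1)\<close>. The linear term comes from the
  correlation of \<open>R\<close> with \<open>log_reps\<close>, and the terms linear in \<open>R\<close> alone sum to zero.\<close>

lemma tilted_coupling_decreases_relative_entropy:
  assumes fin: "finite F" and ne: "F \<noteq> {}" and uc: "union_closed F"
    and t: "\<And>A B. A \<in> F \<Longrightarrow> B \<in> F \<Longrightarrow> t * log_reps_resid F A B \<le> 1"
  defines "U \<equiv> pair_pmf (pmf_of_set F) (pmf_of_set F)"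
  shows "\<exists>P\<in>uniform_couplings F.
    relative_entropy P (ref_dist F) \<le> relative_entropy U (ref_dist F) - t * (1 - t) * interaction_var F"
proof -
  define N where "N = real (card F)"
  have N: "0 < N" using fin ne by (simp add: N_def card_gt_0_iff)
  define x where "x \<omega> = 1 - t * log_reps_resid F (fst \<omega>) (snd \<omega>)" for \<omega>
  have x: "0 \<le> x \<omega>" if "\<omega> \<in> F \<times> F" for \<omega> using that t by (auto simp: x_def)
  let ?f = "\<lambda>\<omega>. if \<omega> \<in> F \<times> F then x \<omega> / N\<^sup>2 else 0"
  have row: "(\<Sum>B\<in>F. x (A, B)) = N" for A
    by (simp add: x_def sum_subtractf N_def sum_log_reps_resid[OF fin ne] flip: sum_distrib_left)
  have col: "(\<Sum>A\<in>F. x (A, B)) = N" for B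
    using row[of B] by (simp add: x_def log_reps_resid_commute[of F B])
  have "?f \<in> coupling_polytope F"
    using x row col N
    by (auto simp: coupling_polytope_def power2_eq_square simp flip: sum_divide_distrib N_def)
  then obtain P where P: "P \<in> uniform_couplings F" "pmf P = ?f"
    unfolding pmf_image_uniform_couplings[OF fin ne, symmetric] by auto
  have suppP: "set_pmf P \<subseteq> F \<times> F" using P by (simp add: uniform_couplings_def)
  have suppU: "set_pmf U \<subseteq> F \<times> F" using fin ne by (simp add: U_def)
  let ?c = "\<lambda>\<omega>. log_reps F (fst \<omega>) (snd \<omega>)" and ?R = "\<lambda>\<omega>. log_reps_resid F (fst \<omega>) (snd \<omega>)"
  have sumR: "(\<Sum>\<omega>\<in>F \<times> F. ?R \<omega>) = 0"
    using sum_log_reps_resid[OF fin ne]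
    by (simp add: sum.cartesian_product[symmetric] case_prod_beta[symmetric])
  have sumRR: "(\<Sum>\<omega>\<in>F \<times> F. (?R \<omega>)\<^sup>2) = N\<^sup>2 * interaction_var F"
    using N by (simp add: interaction_var_def N_def sum.cartesian_product case_prod_beta)
  have sumRc: "(\<Sum>\<omega>\<in>F \<times> F. ?R \<omega> * ?c \<omega>) = N\<^sup>2 * interaction_var F"
    unfolding sumRR[symmetric] using sum_resid_times_log_reps[OF fin ne]
    by (simp add: sum.cartesian_product case_prod_beta)
  have "(\<Sum>\<omega>\<in>F \<times> F. pmf P \<omega> * ln (pmf P \<omega>) + pmf P \<omega> * ?c \<omega>) \<le>
      (\<Sum>\<omega>\<in>F \<times> F. ((?c \<omega> - ln (N\<^sup>2)) - t * (1 - ln (N\<^sup>2)) * ?R \<omega> + t\<^sup>2 * (?R \<omega>)\<^sup>2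
        - t * (?R \<omega> * ?c \<omega>)) / N\<^sup>2)"
  proof (rule sum_mono)
    fix \<omega> assume \<omega>: "\<omega> \<in> F \<times> F"
    have "x \<omega> * ln (x \<omega>) \<le> x \<omega> * (x \<omega> - 1)"
      using x[OF \<omega>] ln_le_minus_one[of "x \<omega>"]
      by (cases "x \<omega> = 0") (auto intro!: mult_left_mono)
    moreover have "x \<omega> * ln (x \<omega> / N\<^sup>2) = x \<omega> * ln (x \<omega>) - x \<omega> * ln (N\<^sup>2)"
      using x[OF \<omega>] N by (cases "x \<omega> = 0") (auto simp: ln_div less_le right_diff_distrib)
    ultimately have "x \<omega> * ln (x \<omega> / N\<^sup>2) + x \<omega> * ?c \<omega> \<le>
        x \<omega> * (x \<omega> - 1) - x \<omega> * ln (N\<^sup>2) + x \<omega> * ?c \<omega>"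
      by simp
    also have "\<dots> = (?c \<omega> - ln (N\<^sup>2)) - t * (1 - ln (N\<^sup>2)) * ?R \<omega> + t\<^sup>2 * (?R \<omega>)\<^sup>2
        - t * (?R \<omega> * ?c \<omega>)"
      by (simp add: x_def algebra_simps power2_eq_square)
    finally have "(x \<omega> * ln (x \<omega> / N\<^sup>2) + x \<omega> * ?c \<omega>) / N\<^sup>2 \<le>
        ((?c \<omega> - ln (N\<^sup>2)) - t * (1 - ln (N\<^sup>2)) * ?R \<omega> + t\<^sup>2 * (?R \<omega>)\<^sup>2
        - t * (?R \<omega> * ?c \<omega>)) / N\<^sup>2"
      by (rule divide_right_mono) simp
    then show "pmf P \<omega> * ln (pmf P \<omega>) + pmf P \<omega> * ?c \<omega> \<le>
        ((?c \<omega> - ln (N\<^sup>2)) - t * (1 - ln (N\<^sup>2)) * ?R \<omega> + t\<^sup>2 * (?R \<omega>)\<^sup>2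
        - t * (?R \<omega> * ?c \<omega>)) / N\<^sup>2"
      using \<omega> by (simp add: P(2) add_divide_distrib)
  qed
  also have "\<dots> = ((\<Sum>\<omega>\<in>F \<times> F. ?c \<omega> - ln (N\<^sup>2)) - t * (1 - ln (N\<^sup>2)) * (\<Sum>\<omega>\<in>F \<times> F. ?R \<omega>)
      + t\<^sup>2 * (\<Sum>\<omega>\<in>F \<times> F. (?R \<omega>)\<^sup>2) - t * (\<Sum>\<omega>\<in>F \<times> F. ?R \<omega> * ?c \<omega>)) / N\<^sup>2"
    by (simp only: sum_divide_distrib[symmetric] sum.distrib sum_subtractf sum_distrib_left)
  also have "\<dots> = (\<Sum>\<omega>\<in>F \<times> F. ?c \<omega> - ln (N\<^sup>2)) / N\<^sup>2 - t * (1 - t) * interaction_var F"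
    unfolding sumR sumRR sumRc using N by (simp add: field_simps power2_eq_square)
  also have "(\<Sum>\<omega>\<in>F \<times> F. ?c \<omega> - ln (N\<^sup>2)) / N\<^sup>2 =
      (\<Sum>\<omega>\<in>F \<times> F. pmf U \<omega> * ln (pmf U \<omega>) + pmf U \<omega> * ?c \<omega>)"
    unfolding sum_divide_distrib
  proof (rule sum.cong[OF refl])
    fix \<omega> assume "\<omega> \<in> F \<times> F"
    then have "pmf U \<omega> = 1 / N\<^sup>2"
      unfolding U_def N_def by (rule pmf_independent_pair[OF fin ne])
    then show "(?c \<omega> - ln (N\<^sup>2)) / N\<^sup>2 = pmf U \<omega> * ln (pmf U \<omega>) + pmf U \<omega> * ?c \<omega>"
      using N by (simp add: ln_div diff_divide_distrib)
  qed
  finally show ?thesis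
    using P(1) unfolding relative_entropy_ref_dist[OF fin ne uc suppU]
    by (intro bexI[of _ P]) (simp_all add: relative_entropy_ref_dist[OF fin ne uc suppP])
qed

section \<open>Lower bound for the interaction variance\<close>

lemma Union_mem_union_closed:
  assumes "finite F" "F \<noteq> {}" "union_closed F"
  shows "\<Union>F \<in> F"
proof -
  have "\<Union>G \<in> F" if "finite G" "G \<noteq> {}" "G \<subseteq> F" for G
    using that
  proof (induction G rule: finite_ne_induct)
    case (insert A G)
    then show ?case using assms(3) by (simp add: union_closed_def)
  qed simp
  then show ?thesis using assms by blast
qed

lemma num_reps_minimal:
  assumes "M \<in> F" "\<And>A. A \<in> F \<Longrightarrow> A \<subseteq> M \<Longrightarrow> A = M"
  shows "num_reps F M = 1"
proof -
  have "{(A, B). A \<in> F \<and> B \<in> F \<and> A \<union> B = M} = {(M, M)}"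
    using assms by blast
  then show ?thesis by (simp add: num_reps_def)
qed

text \<open>Every pair with \<open>T\<close> in at least one coordinate has union \<open>T\<close>.\<close>

lemma num_reps_greatest:
  assumes fin: "finite F" and T: "T \<in> F" and "\<And>A. A \<in> F \<Longrightarrow> A \<subseteq> T"
  shows "2 * card F - 1 \<le> num_reps F T"
proof -
  have "(F \<times> {T}) \<inter> ({T} \<times> F) = {(T, T)}" using T by auto
  then have "card (F \<times> {T} \<union> {T} \<times> F) + 1 = 2 * card F"
    using card_Un_Int[of "F \<times> {T}" "{T} \<times> F"] fin by (simp add: card_cartesian_product)
  moreover have "card (F \<times> {T} \<union> {T} \<times> F) \<le> num_reps F T"
    unfolding num_reps_def
  proof (rule card_mono)
    show "finite {(A, B). A \<in> F \<and> B \<in> F \<and> A \<union> B = T}"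
      by (rule finite_subset[of _ "F \<times> F"]) (use fin in auto)
  qed (use assms in auto)
  ultimately show ?thesis by simp
qed

text \<open>The Cauchy-Schwarz inequality against the vector \<open>(1, -1, -1, 1)\<close>, proved through
  Lagrange's identity.\<close>

lemma contrast_squared_le:
  fixes a b c d :: real
  shows "(a - b - c + d)\<^sup>2 \<le> 4 * (a\<^sup>2 + b\<^sup>2 + c\<^sup>2 + d\<^sup>2)"
proof -
  have "4 * (a\<^sup>2 + b\<^sup>2 + c\<^sup>2 + d\<^sup>2) - (a - b - c + d)\<^sup>2 =
      (a + b)\<^sup>2 + (a + c)\<^sup>2 + (a - d)\<^sup>2 + (b - c)\<^sup>2 + (b + d)\<^sup>2 + (c + d)\<^sup>2"
    by (simp add: power2_eq_square algebra_simps)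
  then show ?thesis by (smt (verit) zero_le_power2)
qed

text \<open>Only four of the squared residuals are used, those of the pairs formed from a minimal
  member \<open>M\<close> and the largest member \<open>T\<close>. Three of these four pairs have union \<open>T\<close>, the fourth has union \<open>M\<close>, so
  their contrast isolates \<open>ln (num_reps F T)\<close>.\<close>

lemma interaction_var_ge:
  assumes fin: "finite F" and uc: "union_closed F" and N: "2 \<le> card F"
  shows "(ln (2 * real (card F) - 1))\<^sup>2 / (4 * (real (card F))\<^sup>2) \<le> interaction_var F"
proof -
  have ne: "F \<noteq> {}" using N by auto
  define T where "T = \<Union>F"
  have T: "T \<in> F" "\<And>A. A \<in> F \<Longrightarrow> A \<subseteq> T"
    using Union_mem_union_closed[OF fin ne uc] by (auto simp: T_def)
  obtain M where M: "M \<in> F" "\<And>A. A \<in> F \<Longrightarrow> A \<subseteq> M \<Longrightarrow> A = M"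
    using finite_has_minimal[OF fin ne] by blast
  have "M \<noteq> T"
  proof
    assume "M = T"
    then have "F = {T}" using M T by blast
    then show False using N by simp
  qed
  let ?R = "log_reps_resid F"
  have "M \<union> T = T" "T \<union> M = T" using T(2)[OF M(1)] by auto
  then have "?R M M - ?R M T - ?R T M + ?R T T = - ln (real (num_reps F T))"
    by (simp add: log_reps_resid_def log_reps_def num_reps_minimal[OF M])
  then have "(ln (real (num_reps F T)))\<^sup>2 \<le>
      4 * ((?R M M)\<^sup>2 + (?R M T)\<^sup>2 + (?R T M)\<^sup>2 + (?R T T)\<^sup>2)"
    using contrast_squared_le[of "?R M M" "?R M T" "?R T M" "?R T T"] by simp
  also have "(?R M M)\<^sup>2 + (?R M T)\<^sup>2 + (?R T M)\<^sup>2 + (?R T T)\<^sup>2 =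
      (\<Sum>(A, B)\<in>{M, T} \<times> {M, T}. (?R A B)\<^sup>2)"
    using \<open>M \<noteq> T\<close> by (simp flip: sum.cartesian_product)
  also have "\<dots> \<le> (\<Sum>(A, B)\<in>F \<times> F. (?R A B)\<^sup>2)"
    by (rule sum_mono2) (use fin M T in auto)
  also have "\<dots> = (real (card F))\<^sup>2 * interaction_var F"
    using N by (simp add: interaction_var_def sum.cartesian_product)
  finally have V: "(ln (real (num_reps F T)))\<^sup>2 \<le> 4 * ((real (card F))\<^sup>2 * interaction_var F)"
    by simp
  have "2 * real (card F) - 1 \<le> real (num_reps F T)"
    using num_reps_greatest[OF fin T] by linarith
  then have "(ln (2 * real (card F) - 1))\<^sup>2 \<le> (ln (real (num_reps F T)))\<^sup>2"
    using N by (intro power_mono ln_mono ln_ge_zero) auto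
  also note V
  finally show ?thesis using N by (simp add: field_simps)
qed

section \<open>The entropy gain of the optimal coupling\<close>

theorem theorem10p2:
  fixes n N :: nat and F :: "nat set set" and \<epsilon> V :: real
  assumes "F \<subseteq> Pow {1..n}"
    and "union_closed F"
    and "N = card F" and "N \<ge> 2"
    and "\<epsilon> = 1 / (8 * ln (real N))"
    and "V = interaction_var F"
  shows "(\<exists>!P. is_optimal_coupling F P) \<and>
    (\<forall>P \<nu> \<nu>0. is_optimal_coupling F P \<longrightarrow>
       \<nu> = union_law P \<longrightarrow>
       \<nu>0 = union_law (pair_pmf (pmf_of_set F) (pmf_of_set F)) \<longrightarrow>
       shannon_entropy \<nu> - shannon_entropy \<nu>0 \<ge> \<epsilon> * (1 - \<epsilon>) * V \<and>
       \<epsilon> * (1 - \<epsilon>) * V \<ge> V / (16 * ln (real N)) \<and>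
       V / (16 * ln (real N)) \<ge> (ln (2 * real N - 1))\<^sup>2 / (64 * (real N)\<^sup>2 * ln (real N)) \<and>
       (ln (2 * real N - 1))\<^sup>2 / (64 * (real N)\<^sup>2 * ln (real N)) > 0)"
proof (intro conjI allI impI)
  have fin: "finite F" by (rule finite_subset[OF assms(1)]) simp
  have ne: "F \<noteq> {}" using assms(3,4) by auto
  note uc = assms(2) and N = assms(3,4) and \<epsilon> = assms(5) and V = assms(6)
  \<comment> \<open>The bound \<open>1/2 \<le> ln 2\<close> gives \<open>\<epsilon> \<le> 1/2\<close>, so that the factor \<open>1 - \<epsilon>\<close> costs at most one half.\<close>
  have "exp (1/2) \<le> (2::real)" using exp_bound_half[of "1/2 :: real"] by simp
  then have "1/2 \<le> ln (2::real)" by (subst ln_ge_iff) auto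
  also have "\<dots> \<le> ln (real N)" using N by (intro ln_mono) auto
  finally have ln: "1/2 \<le> ln (real N)" .
  then have \<epsilon>_bounds: "0 < \<epsilon>" "\<epsilon> \<le> 1/2" "8 * ln (real N) * \<epsilon> = 1"
    by (auto simp: \<epsilon> field_simps)
  have V_ge: "(ln (2 * real N - 1))\<^sup>2 / (4 * (real N)\<^sup>2) \<le> V"
    unfolding V N(1) by (rule interaction_var_ge[OF fin uc]) (use N in simp)
  then have "0 \<le> V" by (rule order_trans[rotated]) simp
  show "\<exists>!P. is_optimal_coupling F P" by (rule ex1_optimal_coupling[OF fin ne uc])
  fix P \<nu> \<nu>0
  assume opt: "is_optimal_coupling F P" and \<nu>: "\<nu> = union_law P"
    and \<nu>0: "\<nu>0 = union_law (pair_pmf (pmf_of_set F) (pmf_of_set F))"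
  let ?U = "pair_pmf (pmf_of_set F) (pmf_of_set F)" and ?D = "\<lambda>P. relative_entropy P (ref_dist F)"
  have P: "set_pmf P \<subseteq> F \<times> F" "\<And>P'. P' \<in> uniform_couplings F \<Longrightarrow> ?D P \<le> ?D P'"
    using opt by (auto simp: is_optimal_coupling_def is_arg_min_linorder uniform_couplings_def)
  have "\<epsilon> * log_reps_resid F A B \<le> 1" if "A \<in> F" "B \<in> F" for A B
  proof -
    have "\<epsilon> * log_reps_resid F A B \<le> \<epsilon> * (4 * ln (real N))"
      using log_reps_resid_le[OF fin that] \<epsilon>_bounds N by (intro mult_left_mono) auto
    also have "\<dots> \<le> 1" using \<epsilon>_bounds(3) by (simp add: mult_ac)
    finally show ?thesis .
  qed
  then obtain P' where "P' \<in> uniform_couplings F" "?D P' \<le> ?D ?U - \<epsilon> * (1 - \<epsilon>) * V"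
    using tilted_coupling_decreases_relative_entropy[OF fin ne uc, of \<epsilon>] V by auto
  then show "shannon_entropy \<nu> - shannon_entropy \<nu>0 \<ge> \<epsilon> * (1 - \<epsilon>) * V"
    using shannon_entropy_union_law_ge[OF fin ne uc P(1)] P(2)[of P']
      shannon_entropy_union_law_independent[OF fin ne uc]
    unfolding \<nu> \<nu>0 by linarith
  have "\<epsilon> * (1/2) * V \<le> \<epsilon> * (1 - \<epsilon>) * V"
    using \<epsilon>_bounds \<open>0 \<le> V\<close> by (intro mult_right_mono mult_left_mono) auto
  then show "\<epsilon> * (1 - \<epsilon>) * V \<ge> V / (16 * ln (real N))" by (simp add: \<epsilon>)
  show "V / (16 * ln (real N)) \<ge> (ln (2 * real N - 1))\<^sup>2 / (64 * (real N)\<^sup>2 * ln (real N))"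
    using divide_right_mono[OF V_ge, of "16 * ln (real N)"] ln by (simp add: mult_ac)
  have "0 < ln (2 * real N - 1)" using N by simp
  then show "(ln (2 * real N - 1))\<^sup>2 / (64 * (real N)\<^sup>2 * ln (real N)) > 0"
    using N ln by (intro divide_pos_pos mult_pos_pos) auto
qed

end
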